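(* Let $\mathcal{C}$ be an exact-repair regenerating code with parameters $\{(n,k,d),(\alpha,\beta),B\}$, $n\ge d+1$, $k\ge 3$, where $\alpha=(d-p+1)\beta-\theta$ with $p\in\{1,\dots,k\}$, $\theta\in[0,\beta)$ ($\theta=0$ if $p=k$). Define, for $p\in\{2,\dots,k-1\}$, with $q_0=\lfloor (k-p+1)/p\rfloor$, $$\epsilon_0=\begin{cases}\dfrac{(d-k+1)(k-p)(\beta-\theta)-\theta}{(d-k+1)(k-p+1)+1}, & k-p+1<p,\\[2ex] \dfrac{\left(d-\frac{p(q_0+3)}{2}+2\right)q_0(p-1)(\beta-\theta)-\theta}{\left(d-\frac{p(q_0+3)}{2}+2\right)q_0p+1}, & k-p+1\ge p,\end{cases}$$ and, for $p\in\{1,\dots,k-2\}$, with $q_1=\lfloor (k-p)/(p+1)\rfloor$, $$\epsilon_1=\begin{cases}\dfrac{(d-k+1)\left[(k-p-2)\beta+\theta\right]}{(d-k+1)(k-p)+1}, & k-p<p+1,\\[2ex] \dfrac{\left(d-\frac{(p+1)(q_1+3)}{2}+2\right)q_1\left[(p-1)\beta+\theta\right]}{\left(d-\frac{(p+1)(q_1+3)}{2}+2\right)q_1(p+1)+1}, & k-p\ge p+1.\end{cases}$$ Then: (1) if $p=1$ and $\theta\ne0$, then $B\le\hat B-\epsilon_1$; (2) if $p\in\{2,3,\dots,k-2\}$, then $B\le\hat B-\max\{\epsilon_0,\epsilon_1\}$; (3) if $p=k-1$ and $\theta<\frac{d-k+1}{d-k+2}\beta$, then $B\le\hat B-\ep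silon_0$.
   Context: Setting: fix integers $k\le d<n$, a finite field $\mathbb{F}_q$, and reals $\alpha,\beta>0$. An exact-repair regenerating code with parameters $\{(n,k,d),(\alpha,\beta),B\}$: a file $M$ uniformly distributed over $\mathbb{F}_q^B$ (entropies measured in units of $\log q$); node $i\in[n]$ stores $W_i$, a deterministic function of $M$, with $H(W_i)\le\alpha$; (data collection) for every $K\subseteq[n]$ with $|K|=k$, $M$ is a function of $(W_a)_{a\in K}$; (exact repair) for every node $y$ and every set $D\subseteq[n]\setminus\{y\}$ with $|D|=d$, each $x\in D$ sends helper data (depending on $y$ and $D$), a deterministic function of $W_x$ of entropy at most $\beta$, from which $W_y$ is exactly recoverable. Notation $[i]=\{1,\dots,i\}$. The functional-repair optimal file size (cut-set bound) is $\hat B=\sum_{i=1}^k\min\{\alpha,(d-i+1)\beta\}=p\alpha+\sum_{i=p+1}^k(d-i+1)\beta$. *)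

theory Defs
  imports Complex_Main
begin

text \<open>The file M is uniformly distributed over F_q^B; we model F_q^B as the
lists of length B over a finite field type 'f.\<close>

definition msgs :: "nat \<Rightarrow> 'f list set" where
  "msgs B = {xs. length xs = B}"

text \<open>Entropy (in units of log q, q = CARD('f)) of a deterministic function f
of the uniformly distributed file M over F_q^B.\<close>

definition ent :: "nat \<Rightarrow> ('f::{finite,field} list \<Rightarrow> 'v) \<Rightarrow> real" where
  "ent B f = (\<Sum>v\<in>f ` msgs B.
      let pv = real (card {m\<in>msgs B. f m = v}) / real (card (msgs B :: 'f list set))
      in - pv * log (real (card (UNIV :: 'f set))) pv)"

text \<open>Exact-repair regenerating code with parameters ((n,k,d),(alpha,beta),B).
W i m : content stored at node i (i in [n]) when the file is m.
S y D x m : helper data sent by node x in D for the repair of node y from helper set D.\<close>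

definition exact_repair_code ::
  "nat \<Rightarrow> nat \<Rightarrow> nat \<Rightarrow> real \<Rightarrow> real \<Rightarrow> nat
   \<Rightarrow> (nat \<Rightarrow> 'f::{finite,field} list \<Rightarrow> 'w)
   \<Rightarrow> (nat \<Rightarrow> nat set \<Rightarrow> nat \<Rightarrow> 'f list \<Rightarrow> 'h) \<Rightarrow> bool" where
  "exact_repair_code n k d \<alpha> \<beta> B W S \<longleftrightarrow>
     (\<forall>i\<in>{1..n}. ent B (W i) \<le> \<alpha>) \<and>
     (\<forall>K. K \<subseteq> {1..n} \<and> card K = k \<longrightarrow>
        (\<forall>m\<in>msgs B. \<forall>m'\<in>msgs B. (\<forall>a\<in>K. W a m = W a m') \<longrightarrow> m = m')) \<and>
     (\<forall>y\<in>{1..n}. \<forall>D. D \<subseteq> {1..n} - {y} \<and> card D = d \<longrightarrow>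
        (\<forall>x\<in>D.
           (\<forall>m\<in>msgs B. \<forall>m'\<in>msgs B. W x m = W x m' \<longrightarrow> S y D x m = S y D x m') \<and>
           ent B (S y D x) \<le> \<beta>) \<and>
        (\<forall>m\<in>msgs B. \<forall>m'\<in>msgs B. (\<forall>x\<in>D. S y D x m = S y D x m') \<longrightarrow> W y m = W y m'))"

text \<open>Functional-repair optimal file size (cut-set bound).\<close>
definition Bhat :: "nat \<Rightarrow> nat \<Rightarrow> real \<Rightarrow> real \<Rightarrow> real" where
  "Bhat k d \<alpha> \<beta> = (\<Sum>i=1..k. min \<alpha> ((real d - real i + 1) * \<beta>))"

definition eps0 :: "nat \<Rightarrow> nat \<Rightarrow> nat \<Rightarrow> real \<Rightarrow> real \<Rightarrow> real" where
  "eps0 k d p \<beta> \<theta> =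
    (if k - p + 1 < p then
       ((real d - real k + 1) * (real k - real p) * (\<beta> - \<theta>) - \<theta>) /
       ((real d - real k + 1) * (real k - real p + 1) + 1)
     else
       (let q0 = real ((k - p + 1) div p);
            c = real d - real p * (q0 + 3) / 2 + 2
        in (c * q0 * (real p - 1) * (\<beta> - \<theta>) - \<theta>) / (c * q0 * real p + 1)))"

definition eps1 :: "nat \<Rightarrow> nat \<Rightarrow> nat \<Rightarrow> real \<Rightarrow> real \<Rightarrow> real" where
  "eps1 k d p \<beta> \<theta> =
    (if k - p < p + 1 then
       ((real d - real k + 1) * ((real k - real p - 2) * \<beta> + \<theta>)) /
       ((real d - real k + 1) * (real k - real p) + 1)
     else
       (let q1 = real ((k - p) div (p + 1));
            c = real d - (real p + 1) * (q1 + 3) / 2 + 2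
        in (c * q1 * ((real p - 1) * \<beta> + \<theta>)) / (c * q1 * (real p + 1) + 1)))"

end

theory Submission
  imports Defs
begin

text \<open>Entropy makes the contents of d + 1 nodes together with all their helper messages a
  polymatroid h; the node x is the element \<open>Inl x\<close>, its message to y the element \<open>Inr (y, x)\<close>.
  Let the gap be the cut-set bound minus B. It is the total slack of the cut-set estimates along
  every chain of k nodes. So a message from x to y is, up to the slack, a function of the content of y and
  r further nodes, while r + 1 nodes share little information with x; hence the messages of x to
  a group L of at most r + 1 nodes have small joint entropy. Repairing the nodes after the first r
  in groups of size g then costs less than the cut-set estimate by an amount that is
  itself bounded by the gap. Choosing r = p - 1 gives the bound \<open>eps0\<close> and r = p gives \<open>eps1\<close>; the
  coefficient M of the saving counts the pairs of a group and a node outside it that helps to repair it.\<close>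

section \<open>Entropy of functions of a uniform message\<close>

definition class_size :: "nat \<Rightarrow> ('f::{finite,field} list \<Rightarrow> 'v) \<Rightarrow> 'f list \<Rightarrow> nat" where
  "class_size B f m = card {m' \<in> msgs B. f m' = f m}"

lemma msgs_alt: "(msgs B :: 'f list set) = {xs. set xs \<subseteq> UNIV \<and> length xs = B}"
  by (auto simp: msgs_def)

lemma finite_msgs [simp]: "finite (msgs B :: 'f::{finite,field} list set)"
  unfolding msgs_alt by (rule finite_lists_length_eq) simp

lemma card_msgs: "card (msgs B :: 'f::{finite,field} list set) = card (UNIV :: 'f set) ^ B"
  unfolding msgs_alt by (rule card_lists_length_eq) simp

lemma card_field_gt_1: "card (UNIV :: 'f::{finite,field} set) > 1"
proof -
  have "card {0, 1 :: 'f} \<le> card (UNIV :: 'f set)" by (rule card_mono) auto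
  thus ?thesis by simp
qed

lemma card_msgs_pos: "card (msgs B :: 'f::{finite,field} list set) > 0"
  using card_field_gt_1[where 'f = 'f] by (simp add: card_msgs)

lemma class_size_pos: "m \<in> msgs B \<Longrightarrow> class_size B f m > 0"
  unfolding class_size_def by (subst card_gt_0_iff) auto

text \<open>Grouping the messages by value turns the sum over values into an average over messages,
  so that entropies of functions with unrelated codomains can be compared message by
  message.\<close>

lemma ent_eq_sum_class_size:
  fixes f :: "'f::{finite,field} list \<Rightarrow> 'v"
  shows "ent B f = - (\<Sum>m\<in>msgs B. log (real (card (UNIV :: 'f set)))
           (real (class_size B f m) / real (card (msgs B :: 'f list set))))
         / real (card (msgs B :: 'f list set))"
proof -
  let ?N = "real (card (msgs B :: 'f list set))" and ?b = "real (card (UNIV :: 'f set))"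
  have "(\<Sum>m\<in>msgs B. log ?b (real (class_size B f m) / ?N))
     = (\<Sum>v\<in>f ` msgs B. \<Sum>m\<in>{m\<in>msgs B. f m = v}. log ?b (real (class_size B f m) / ?N))"
    by (rule sum.image_gen) simp
  also have "\<dots> = (\<Sum>v\<in>f ` msgs B. real (card {m\<in>msgs B. f m = v}) *
        log ?b (real (card {m\<in>msgs B. f m = v}) / ?N))"
    by (intro sum.cong refl) (simp add: class_size_def)
  finally show ?thesis
    by (simp add: ent_def Let_def sum_negf sum_divide_distrib)
qed

lemma ent_mono:
  fixes f :: "'f::{finite,field} list \<Rightarrow> 'v" and g :: "'f list \<Rightarrow> 'u"
  assumes "\<And>m m'. m \<in> msgs B \<Longrightarrow> m' \<in> msgs B \<Longrightarrow> g m = g m' \<Longrightarrow> f m = f m'"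
  shows "ent B f \<le> ent B g"
proof -
  have "class_size B g m \<le> class_size B f m" if "m \<in> msgs B" for m
    unfolding class_size_def
  proof (rule card_mono)
    show "{m' \<in> msgs B. g m' = g m} \<subseteq> {m' \<in> msgs B. f m' = f m}"
      using assms that by blast
  qed simp
  hence "(\<Sum>m\<in>msgs B. log (real (card (UNIV :: 'f set)))
           (real (class_size B g m) / real (card (msgs B :: 'f list set))))
     \<le> (\<Sum>m\<in>msgs B. log (real (card (UNIV :: 'f set)))
           (real (class_size B f m) / real (card (msgs B :: 'f list set))))"
    using card_field_gt_1[where 'f = 'f] card_msgs_pos[of B, where 'f = 'f] class_size_pos[of _ B]
    by (intro sum_mono log_mono divide_right_mono divide_pos_pos) auto
  thus ?thesis unfolding ent_eq_sum_class_size by (simp add: divide_right_mono)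
qed

lemma ent_const:
  fixes f :: "'f::{finite,field} list \<Rightarrow> 'v"
  assumes "\<And>m m'. f m = f m'"
  shows "ent B f = 0"
proof -
  have "{m' \<in> msgs B. f m' = f m} = msgs B" for m using assms[of _ m] by auto
  hence "class_size B f m = card (msgs B :: 'f list set)" for m
    by (simp add: class_size_def)
  thus ?thesis using card_msgs_pos[of B, where 'f = 'f] by (simp add: ent_eq_sum_class_size)
qed

lemma ent_inj:
  fixes f :: "'f::{finite,field} list \<Rightarrow> 'v"
  assumes "inj_on f (msgs B)"
  shows "ent B f = real B"
proof -
  have "class_size B f m = 1" if "m \<in> msgs B" for m
  proof -
    have "{m' \<in> msgs B. f m' = f m} = {m}" using assms that by (auto dest: inj_onD)
    thus ?thesis by (simp add: class_size_def)
  qed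
  moreover have "log (real (card (UNIV :: 'f set))) (1 / real (card (UNIV :: 'f set)) ^ B) = - real B"
    using card_field_gt_1[where 'f = 'f]
    by (simp add: log_divide log_nat_power)
  ultimately show ?thesis using card_msgs_pos[of B, where 'f = 'f]
    by (simp add: ent_eq_sum_class_size card_msgs)
qed

text \<open>In terms of probabilities, p(f) p(g) / p(i), the law that makes \<open>F\<close> and
  \<open>G\<close> independent given \<open>I\<close>, has mass at most 1 on the support of (F, G).
  The term for m counts pairs (a, b) from the \<open>F\<close>-class and the \<open>G\<close>-class
  of m, and the resulting triple sum is evaluated over m first.\<close>

lemma sum_class_size_quotient_le:
  fixes F :: "'f::{finite,field} list \<Rightarrow> 'a" and G :: "'f list \<Rightarrow> 'b"
    and U :: "'f list \<Rightarrow> 'c" and I :: "'f list \<Rightarrow> 'd"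
  assumes U: "\<And>m m'. U m = U m' \<longleftrightarrow> F m = F m' \<and> G m = G m'"
    and FI: "\<And>m m'. F m = F m' \<Longrightarrow> I m = I m'"
    and GI: "\<And>m m'. G m = G m' \<Longrightarrow> I m = I m'"
  shows "(\<Sum>m\<in>msgs B. real (class_size B F m) * real (class_size B G m) /
            (real (class_size B U m) * real (class_size B I m)))
         \<le> real (card (msgs B :: 'f list set))"
proof -
  let ?M = "msgs B :: 'f list set"
  let ?T = "\<lambda>m a b. (if F a = F m \<and> G b = G m then 1 / real (class_size B U m) else 0)
              * (if I a = I b then 1 / real (class_size B I a) else 0)"
  have ind: "real (class_size B f m) = (\<Sum>a\<in>?M. if f a = f m then 1 else 0)"
    for f :: "'f list \<Rightarrow> 'v" and m
    by (simp add: class_size_def sum.If_cases Int_def)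
  \<comment> \<open>Both classes lie inside the \<open>I\<close>-class of m, so
    \<open>I a = I b\<close> holds for every counted pair; the condition does not mention m and
    survives the exchange of sums.\<close>
  have expand: "real (class_size B F m) * real (class_size B G m) /
            (real (class_size B U m) * real (class_size B I m)) = (\<Sum>a\<in>?M. \<Sum>b\<in>?M. ?T m a b)" for m
  proof -
    have "?T m a b = (if F a = F m then 1 else 0) * (if G b = G m then 1 else 0) /
            (real (class_size B U m) * real (class_size B I m))" for a b
    proof (cases "F a = F m \<and> G b = G m")
      case True
      hence "I a = I m" "I b = I m" using FI GI by blast+
      moreover from this have "class_size B I a = class_size B I m" by (simp add: class_size_def)
      ultimately show ?thesis using True by simp
    qed auto
    thus ?thesis
      by (simp only: ind[of F] ind[of G] sum_product sum_divide_distrib)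
  qed
  \<comment> \<open>The messages m matching a given pair form a single \<open>U\<close>-class or
    none; a class weighted by the inverse of its size has mass 1.\<close>
  have fibre: "(\<Sum>m\<in>?M. if F a = F m \<and> G b = G m then 1 / real (class_size B U m) else 0) \<le> 1" for a b
  proof (cases "\<exists>m0\<in>?M. F a = F m0 \<and> G b = G m0")
    case True
    then obtain m0 where m0: "m0 \<in> ?M" "F a = F m0" "G b = G m0" by blast
    have "(\<Sum>m\<in>?M. if F a = F m \<and> G b = G m then 1 / real (class_size B U m) else 0)
        = (\<Sum>m\<in>?M. if U m = U m0 then 1 / real (class_size B U m0) else 0)"
      using m0 by (intro sum.cong refl) (auto simp: U class_size_def)
    also have "\<dots> = (\<Sum>m\<in>?M. if U m = U m0 then 1 else 0) / real (class_size B U m0)"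
      unfolding sum_divide_distrib by (intro sum.cong refl) auto
    also have "\<dots> \<le> 1" using class_size_pos[OF m0(1), of U] by (simp add: ind)
    finally show ?thesis .
  qed (auto intro!: order.trans[OF sum_nonpos])
  have "(\<Sum>m\<in>?M. \<Sum>a\<in>?M. \<Sum>b\<in>?M. ?T m a b) = (\<Sum>a\<in>?M. \<Sum>b\<in>?M. \<Sum>m\<in>?M. ?T m a b)"
    by (rule trans[OF sum.swap]) (intro sum.cong refl sum.swap)
  also have "\<dots> = (\<Sum>a\<in>?M. \<Sum>b\<in>?M.
      (\<Sum>m\<in>?M. if F a = F m \<and> G b = G m then 1 / real (class_size B U m) else 0)
      * (if I a = I b then 1 / real (class_size B I a) else 0))"
    by (simp only: sum_distrib_right)
  also have "\<dots> \<le> (\<Sum>a\<in>?M. \<Sum>b\<in>?M. 1 * (if I a = I b then 1 / real (class_size B I a) else 0))"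
    by (intro sum_mono mult_right_mono fibre) auto
  also have "\<dots> = (\<Sum>a\<in>?M. 1)"
  proof (intro sum.cong refl)
    fix a assume a: "a \<in> ?M"
    have "(\<Sum>b\<in>?M. 1 * (if I a = I b then 1 / real (class_size B I a) else 0))
        = (\<Sum>b\<in>?M. if I b = I a then 1 else 0) / real (class_size B I a)"
      unfolding sum_divide_distrib by (intro sum.cong refl) auto
    thus "(\<Sum>b\<in>?M. 1 * (if I a = I b then 1 / real (class_size B I a) else 0)) = (1 :: real)"
      using class_size_pos[OF a, of I] by (simp add: ind[symmetric])
  qed
  finally show ?thesis by (simp add: expand)
qed

text \<open>Nonnegativity of the conditional mutual information of \<open>F\<close> and
  \<open>G\<close> given \<open>I\<close>: \<open>ln x \<le> x - 1\<close> is applied to each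
  class-size quotient, and these average to at most 1. Describing \<open>U\<close> and
  \<open>I\<close> through equality of values lets joint variables of unions and intersections be
  substituted directly.\<close>

lemma ent_submodular:
  fixes F :: "'f::{finite,field} list \<Rightarrow> 'a" and G :: "'f list \<Rightarrow> 'b"
    and U :: "'f list \<Rightarrow> 'c" and I :: "'f list \<Rightarrow> 'd"
  assumes U: "\<And>m m'. U m = U m' \<longleftrightarrow> F m = F m' \<and> G m = G m'"
    and FI: "\<And>m m'. F m = F m' \<Longrightarrow> I m = I m'"
    and GI: "\<And>m m'. G m = G m' \<Longrightarrow> I m = I m'"
  shows "ent B U + ent B I \<le> ent B F + ent B G"
proof -
  let ?M = "msgs B :: 'f list set" and ?b = "real (card (UNIV :: 'f set))"
  let ?N = "real (card ?M)"
  let ?c = "\<lambda>m. real (class_size B F m) * real (class_size B G m) /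
            (real (class_size B U m) * real (class_size B I m))"
  let ?l = "\<lambda>x. log ?b (x / ?N)"
  have b: "?b > 1" and N: "?N > 0"
    using card_field_gt_1[where 'f = 'f] card_msgs_pos[of B, where 'f = 'f] by auto
  have pointwise: "?l (class_size B F m) + ?l (class_size B G m)
      - ?l (class_size B U m) - ?l (class_size B I m) \<le> (?c m - 1) / ln ?b" if m: "m \<in> ?M" for m
  proof -
    note pos = class_size_pos[OF m, of F] class_size_pos[OF m, of G]
      class_size_pos[OF m, of U] class_size_pos[OF m, of I]
    have "?l (class_size B F m) + ?l (class_size B G m)
      - ?l (class_size B U m) - ?l (class_size B I m) = ln (?c m) / ln ?b"
      using pos N b card_msgs_pos[of B, where 'f = 'f]
      by (simp add: card_gt_0_iff log_def ln_div ln_mult diff_divide_distrib add_divide_distrib)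
    also have "\<dots> \<le> (?c m - 1) / ln ?b"
      using pos b by (intro divide_right_mono ln_le_minus_one) auto
    finally show ?thesis .
  qed
  have "(\<Sum>m\<in>?M. ?l (class_size B F m)) + (\<Sum>m\<in>?M. ?l (class_size B G m))
      - (\<Sum>m\<in>?M. ?l (class_size B U m)) - (\<Sum>m\<in>?M. ?l (class_size B I m))
      \<le> (\<Sum>m\<in>?M. (?c m - 1) / ln ?b)"
    unfolding sum.distrib[symmetric] sum_subtractf[symmetric]
    by (intro sum_mono pointwise)
  also have "\<dots> = ((\<Sum>m\<in>?M. ?c m) - ?N) / ln ?b"
    by (simp add: sum_divide_distrib[symmetric] sum_subtractf)
  also have "\<dots> \<le> 0"
    using sum_class_size_quotient_le[of U F G I B, OF U FI GI] b
    by (intro divide_nonpos_pos) auto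
  finally have "(\<Sum>m\<in>?M. ?l (class_size B F m)) + (\<Sum>m\<in>?M. ?l (class_size B G m))
      \<le> (\<Sum>m\<in>?M. ?l (class_size B U m)) + (\<Sum>m\<in>?M. ?l (class_size B I m))" by simp
  from divide_right_mono[OF this, of ?N] N show ?thesis
    by (simp add: ent_eq_sum_class_size add_divide_distrib)
qed

section \<open>Repair in an abstract polymatroid\<close>

text \<open>Only d + 1 nodes are kept, so the helpers of y are all the others and a message is
  indexed by receiver and sender alone. That an element is a function of a set is expressed by
  saying that adjoining it does not raise h.\<close>

locale repair_polymatroid =
  fixes h :: "(nat + nat \<times> nat) set \<Rightarrow> real" and d k :: nat and \<alpha> \<beta> B :: real
  assumes mono: "A \<subseteq> C \<Longrightarrow> h A \<le> h C"
    and submodular: "h (A \<union> C) + h (A \<inter> C) \<le> h A + h C"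
    and empty: "h {} = 0"
    and node_le: "x \<in> {1..d+1} \<Longrightarrow> h {Inl x} \<le> \<alpha>"
    and helper_le: "x \<in> {1..d+1} \<Longrightarrow> y \<in> {1..d+1} \<Longrightarrow> x \<noteq> y \<Longrightarrow> h {Inr (y, x)} \<le> \<beta>"
    and helper_determined:
      "x \<in> {1..d+1} \<Longrightarrow> y \<in> {1..d+1} \<Longrightarrow> x \<noteq> y \<Longrightarrow> h {Inr (y, x), Inl x} \<le> h {Inl x}"
    and repair: "y \<in> {1..d+1} \<Longrightarrow>
      h (insert (Inl y) ((\<lambda>x. Inr (y, x)) ` ({1..d+1} - {y}))) \<le> h ((\<lambda>x. Inr (y, x)) ` ({1..d+1} - {y}))"
    and file_size: "K \<subseteq> {1..d+1} \<Longrightarrow> card K = k \<Longrightarrow> h (Inl ` K) = B"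
    and k_le_d: "k \<le> d"
    and beta_nonneg: "\<beta> \<ge> 0"
begin

abbreviation V :: "nat set" where "V \<equiv> {1..d+1}"

abbreviation w :: "nat set \<Rightarrow> real" where "w A \<equiv> h (Inl ` A)"

text \<open>The cut-set cost of a node when i others are known; counting from 0 shifts the index by
  one against \<open>Bhat\<close>.\<close>

definition cap :: "nat \<Rightarrow> real" where "cap i = min \<alpha> ((real d - real i) * \<beta>)"

definition gap :: real where "gap = (\<Sum>i=0..<k. cap i) - B"

section \<open>Polymatroid inequalities and a single repair\<close>

lemma finite_subset_V: "A \<subseteq> V \<Longrightarrow> finite A"
  by (rule finite_subset) auto

lemma insert_antimono_increment:
  assumes "Y \<subseteq> Z"
  shows "h (insert e Z) + h Y \<le> h Z + h (insert e Y)"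
proof -
  have "Z \<union> insert e Y = insert e Z" using assms by auto
  \<comment> \<open>The intersection also contains e when e lies in \<open>Z\<close>, so it may
    exceed \<open>Y\<close>.\<close>
  moreover have "h Y \<le> h (Z \<inter> insert e Y)" by (rule mono) (use assms in auto)
  ultimately show ?thesis using submodular[of Z "insert e Y"] by simp
qed

lemma insert_determined:
  assumes "Y \<subseteq> Z" "h (insert e Y) \<le> h Y"
  shows "h (insert e Z) \<le> h Z"
  using insert_antimono_increment[OF assms(1), of e] assms(2) by simp

text \<open>The sets are adjoined one at a time; over a base that already contains \<open>Z\<close>,
  submodularity makes each increment at most the one over \<open>Z\<close>.\<close>

lemma Union_le:
  assumes "finite I"
  shows "h (Z \<union> \<Union> (T ` I)) \<le> h Z + (\<Sum>i\<in>I. h (Z \<union> T i) - h Z)"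
  using assms
proof induction
  case (insert i I)
  have "h (Z \<union> \<Union> (T ` I) \<union> (Z \<union> T i)) + h ((Z \<union> \<Union> (T ` I)) \<inter> (Z \<union> T i))
     \<le> h (Z \<union> \<Union> (T ` I)) + h (Z \<union> T i)" by (rule submodular)
  moreover have "h Z \<le> h ((Z \<union> \<Union> (T ` I)) \<inter> (Z \<union> T i))" by (rule mono) auto
  moreover have "Z \<union> \<Union> (T ` I) \<union> (Z \<union> T i) = Z \<union> \<Union> (T ` insert i I)" by auto
  ultimately show ?case using insert by simp
qed simp

text \<open>Messages already in \<open>Z\<close>, or sent by a node in \<open>Z\<close>, are free;
  any other message costs at most \<beta>. The messages stay in the set on the left because a later
  estimate needs y jointly with one of them.\<close>

lemma repair_step:
  assumes y: "y \<in> V"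
    and T: "{x \<in> V - {y}. Inl x \<notin> Z \<and> Inr (y, x) \<notin> Z} \<subseteq> T" "finite T"
  shows "h (insert (Inl y) (Z \<union> (\<lambda>x. Inr (y, x)) ` (V - {y}))) \<le> h Z + real (card T) * \<beta>"
proof -
  let ?R = "V - {y}"
  let ?S = "(\<lambda>x. Inr (y, x)) ` ?R"
  have "h (insert (Inl y) (Z \<union> ?S)) \<le> h (Z \<union> ?S)"
    by (rule insert_determined[OF _ repair[OF y]]) auto
  also have "h (Z \<union> ?S) = h (Z \<union> \<Union> ((\<lambda>x. {Inr (y, x)}) ` ?R))"
    by (rule arg_cong[of _ _ h]) auto
  also have "\<dots> \<le> h Z + (\<Sum>x\<in>?R. h (Z \<union> {Inr (y, x)}) - h Z)"
    by (rule Union_le) simp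
  also have "(\<Sum>x\<in>?R. h (Z \<union> {Inr (y, x)}) - h Z) \<le> (\<Sum>x\<in>?R. if x \<in> T then \<beta> else 0)"
  proof (rule sum_mono)
    fix x assume x: "x \<in> ?R"
    have *: "h (insert (Inr (y, x)) Z) \<le> h Z + \<beta>"
      using insert_antimono_increment[of "{}" Z "Inr (y, x)"] helper_le[of x y] x y empty by simp
    consider "x \<in> T" | "Inl x \<in> Z" | "Inr (y, x) \<in> Z" using T x by auto
    thus "h (Z \<union> {Inr (y, x)}) - h Z \<le> (if x \<in> T then \<beta> else 0)"
    proof cases
      case 1 thus ?thesis using * by simp
    next
      case 2
      hence "h (insert (Inr (y, x)) Z) \<le> h Z"
        using x y by (intro insert_determined[OF _ helper_determined[of x y]]) auto
      thus ?thesis using beta_nonneg by auto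
    next
      case 3 thus ?thesis using beta_nonneg by (simp add: insert_absorb)
    qed
  qed
  also have "\<dots> = real (card (?R \<inter> T)) * \<beta>" by (simp add: sum.If_cases)
  also have "\<dots> \<le> real (card T) * \<beta>"
    using T beta_nonneg by (intro mult_right_mono) (auto intro: card_mono)
  finally show ?thesis by simp
qed

section \<open>Cut-set estimates along chains of nodes\<close>

lemma card_complement:
  assumes "A \<subseteq> V" "y \<in> V" "y \<notin> A"
  shows "real (card (V - insert y A)) = real d - real (card A)"
proof -
  have "finite A" using assms finite_subset_V by auto
  moreover have "card (insert y A) \<le> card V" by (rule card_mono) (use assms in auto)
  ultimately show ?thesis using assms by (subst card_Diff_subset) auto
qed

lemma node_and_helpers_le:
  assumes "A \<subseteq> V" "y \<in> V" "y \<notin> A"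
  shows "h (insert (Inl y) (Inl ` A \<union> (\<lambda>x. Inr (y, x)) ` (V - {y})))
      \<le> w A + (real d - real (card A)) * \<beta>"
proof -
  have "{x \<in> V - {y}. Inl x \<notin> Inl ` A \<and> Inr (y, x) \<notin> Inl ` A} \<subseteq> V - insert y A" by auto
  from repair_step[OF assms(2) this] show ?thesis
    unfolding card_complement[OF assms] by blast
qed

lemma w_insert_le:
  assumes "A \<subseteq> V" "y \<in> V" "y \<notin> A"
  shows "w (insert y A) \<le> w A + cap (card A)"
proof -
  have "w (insert y A) \<le> w A + \<alpha>"
    using insert_antimono_increment[of "{}" "Inl ` A" "Inl y"] node_le[of y] assms empty by simp
  moreover have "w (insert y A) \<le> w A + (real d - real (card A)) * \<beta>"
    by (rule order.trans[OF mono node_and_helpers_le[OF assms]]) auto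
  ultimately show ?thesis by (simp add: cap_def)
qed

lemma w_chain_le:
  assumes "A \<subseteq> C" "C \<subseteq> V"
  shows "w C \<le> w A + (\<Sum>i=card A..<card C. cap i)"
proof -
  have "finite (C - A)" using assms finite_subset_V by blast
  moreover have "w (A \<union> D) \<le> w A + (\<Sum>i=card A..<card (A \<union> D). cap i)"
    if "finite D" "D \<subseteq> C - A" for D
    using that
  proof (induction D)
    case (insert y D)
    have fin: "finite (A \<union> D)"
      using insert assms finite_subset_V by (meson finite_Un finite_subset finite_insert le_sup_iff)
    have "w (insert y (A \<union> D)) \<le> w (A \<union> D) + cap (card (A \<union> D))"
      by (rule w_insert_le) (use insert assms in auto)
    moreover have "card (insert y (A \<union> D)) = Suc (card (A \<union> D))" using fin insert by auto
    moreover have "card A \<le> card (A \<union> D)" using fin by (intro card_mono) auto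
    ultimately show ?case using insert by simp
  qed simp
  ultimately show ?thesis using assms by (metis Un_Diff_cancel Un_absorb1 order_refl)
qed

text \<open>Extend \<open>C\<close> to k nodes, which carry entropy \<open>B\<close>. The parts of
  the chain below \<open>A\<close> and above \<open>C\<close> obey the cut-set estimate, so the part
  between cannot fall short of it by more than the total slack.\<close>

lemma w_chain_ge:
  assumes "A \<subseteq> C" "C \<subseteq> V" "card C \<le> k"
  shows "w A + (\<Sum>i=card A..<card C. cap i) - gap \<le> w C"
proof -
  obtain K where K: "C \<subseteq> K" "K \<subseteq> V" "card K = k"
    using exists_subset_between[of C k V] assms k_le_d by auto
  have "card A \<le> card C" using assms finite_subset_V by (intro card_mono) auto
  hence "(\<Sum>i=0..<k. cap i) = (\<Sum>i=0..<card A. cap i) + (\<Sum>i=card A..<card C. cap i)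
      + (\<Sum>i=card C..<k. cap i)"
    using assms by (simp add: sum.atLeastLessThan_concat)
  moreover have "w A \<le> (\<Sum>i=0..<card A. cap i)"
    using w_chain_le[of "{}" A] assms empty by simp
  moreover have "B \<le> w C + (\<Sum>i=card C..<k. cap i)"
    using w_chain_le[OF K(1,2)] K file_size by simp
  ultimately show ?thesis by (simp add: gap_def)
qed

section \<open>Savings from repairing nodes in groups\<close>

text \<open>A helper's messages to L are almost determined by the nodes L' \<open>\<supseteq>\<close> L, so their joint
  entropy exceeds the small mutual information between x and L' only slightly. Charging one of
  the messages together with that mutual information to a single two-step chain saves one gap.\<close>
lemma helper_messages_le:
  assumes L: "L \<subseteq> L'" "L \<noteq> {}" and L': "L' \<subseteq> V" "card L' = Suc r" and r: "r + 2 \<le> k"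
    and x: "x \<in> V" "x \<notin> L'"
  shows "h ((\<lambda>y. Inr (y, x)) ` L)
     \<le> real (card L) * ((real d - real r) * \<beta> - cap r + gap) + (\<alpha> - cap (Suc r))"
proof -
  let ?S = "(\<lambda>y. Inr (y, x)) ` L" and ?W = "Inl ` L' :: (nat + nat \<times> nat) set"
  have finL: "finite L" "finite L'" using finite_subset_V L L' by (auto intro: finite_subset)
  have Sx: "h (insert (Inl x) ?S) \<le> \<alpha>"
  proof -
    have "h ({Inl x} \<union> \<Union> ((\<lambda>y. {Inr (y, x)}) ` L))
       \<le> h {Inl x} + (\<Sum>y\<in>L. h ({Inl x} \<union> {Inr (y, x)}) - h {Inl x})"
      by (rule Union_le) (rule finL)
    also have "\<dots> \<le> h {Inl x} + (\<Sum>y\<in>L. 0)"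
      using helper_determined[of x] x L L'
      by (intro add_left_mono sum_mono) (fastforce simp: insert_commute)
    finally have "h ({Inl x} \<union> \<Union> ((\<lambda>y. {Inr (y, x)}) ` L)) \<le> h {Inl x}" by simp
    moreover have "{Inl x} \<union> \<Union> ((\<lambda>y. {Inr (y, x)}) ` L) = insert (Inl x) ?S" by auto
    ultimately show ?thesis using node_le[OF x(1)] by simp
  qed
  \<comment> \<open>Submodularity for two sets that share the messages: their entropy is at most
    their conditional entropy given \<open>L'\<close> plus the mutual information of x and
    \<open>L'\<close>, with \<alpha> in place of the entropy of x.\<close>
  have S: "h ?S + w (insert x L') \<le> h (?W \<union> ?S) + \<alpha>"
  proof -
    have "h (?W \<union> ?S \<union> insert (Inl x) ?S) + h ((?W \<union> ?S) \<inter> insert (Inl x) ?S)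
      \<le> h (?W \<union> ?S) + h (insert (Inl x) ?S)" by (rule submodular)
    moreover have "w (insert x L') \<le> h (?W \<union> ?S \<union> insert (Inl x) ?S)" by (rule mono) auto
    moreover have "h ?S \<le> h ((?W \<union> ?S) \<inter> insert (Inl x) ?S)" by (rule mono) auto
    ultimately show ?thesis using Sx by simp
  qed
  \<comment> \<open>Repairing y with the other r nodes of \<open>L'\<close> known yields y and the
    message from x to it at once.\<close>
  have one: "h (?W \<union> {Inr (y, x)}) \<le> w (L' - {y}) + (real d - real r) * \<beta>" if "y \<in> L" for y
  proof -
    have y: "y \<in> L'" using that L by auto
    have "h (?W \<union> {Inr (y, x)})
        \<le> h (insert (Inl y) (Inl ` (L' - {y}) \<union> (\<lambda>x. Inr (y, x)) ` (V - {y})))"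
      by (rule mono) (use x y in auto)
    also have "\<dots> \<le> w (L' - {y}) + (real d - real (card (L' - {y}))) * \<beta>"
      by (rule node_and_helpers_le) (use y L' in auto)
    finally show ?thesis using y finL L' by simp
  qed
  have other: "h (?W \<union> {Inr (y, x)}) - w L' \<le> (real d - real r) * \<beta> - cap r + gap" if "y \<in> L" for y
  proof -
    have y: "y \<in> L'" using that L by auto
    have "w (L' - {y}) + (\<Sum>i=card (L' - {y})..<card L'. cap i) - gap \<le> w L'"
      by (rule w_chain_ge) (use L' r in auto)
    thus ?thesis using one[OF that] y finL L' by simp
  qed
  obtain y where y: "y \<in> L" using L by auto
  \<comment> \<open>The chain climbs from \<open>L' - {y}\<close> to \<open>insert x L'\<close>, a
    set of r + 2 nodes; \<open>r + 2 \<le> k\<close> keeps it within the range of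
    \<open>w_chain_ge\<close>.\<close>
  have first: "h (?W \<union> {Inr (y, x)}) + \<alpha> - w (insert x L')
      \<le> (real d - real r) * \<beta> - cap r + gap + (\<alpha> - cap (Suc r))"
  proof -
    have y': "y \<in> L'" using y L by auto
    have "w (L' - {y}) + (\<Sum>i=card (L' - {y})..<card (insert x L'). cap i) - gap \<le> w (insert x L')"
      by (rule w_chain_ge) (use L' r x finL in auto)
    thus ?thesis using one[OF y] y' finL L' x by simp
  qed
  have "?W \<union> ?S = ?W \<union> \<Union> ((\<lambda>y. {Inr (y, x)}) ` L)" by auto
  hence "h (?W \<union> ?S) \<le> w L' + (\<Sum>y\<in>L. h (?W \<union> {Inr (y, x)}) - w L')"
    using Union_le[OF finL(1)] by metis
  also have "\<dots> = h (?W \<union> {Inr (y, x)}) + (\<Sum>y\<in>L - {y}. h (?W \<union> {Inr (y, x)}) - w L')"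
    using finL y by (simp add: sum.remove)
  also have "\<dots> \<le> h (?W \<union> {Inr (y, x)}) + (\<Sum>y\<in>L - {y}. (real d - real r) * \<beta> - cap r + gap)"
    by (intro add_left_mono sum_mono other) auto
  also have "\<dots> = h (?W \<union> {Inr (y, x)})
      + (real (card L) - 1) * ((real d - real r) * \<beta> - cap r + gap)"
  proof -
    have "card L > 0" using finL y by (auto simp: card_gt_0_iff)
    thus ?thesis using finL y by (simp add: of_nat_diff)
  qed
  finally show ?thesis using S first by (simp add: algebra_simps)
qed

text \<open>All messages to \<open>L\<close> from outside \<open>A \<union> L\<close> are collected
  first, at \<Gamma> per sender instead of \<beta> per message. The nodes of \<open>L\<close> are
  then repaired one by one and pay only for messages from members of \<open>L\<close> still
  missing.\<close>

lemma group_repair_le: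
  assumes A: "A \<subseteq> V" and L: "L \<subseteq> V" "A \<inter> L = {}"
    and \<Gamma>: "\<And>x. x \<in> V - (A \<union> L) \<Longrightarrow> h ((\<lambda>y. Inr (y, x)) ` L) \<le> \<Gamma>"
  shows "w (A \<union> L) \<le> w A + (\<Sum>i=card A..<card A + card L. (real d - real i) * \<beta>)
     - (real d + 1 - real (card A) - real (card L)) * (real (card L) * \<beta> - \<Gamma>)"
proof -
  let ?X = "V - (A \<union> L)"
  let ?m = "real d + 1 - real (card A) - real (card L)"
  let ?S = "\<Union> ((\<lambda>x. (\<lambda>y. Inr (y, x)) ` L) ` ?X) :: (nat + nat \<times> nat) set"
  let ?Z = "Inl ` A \<union> ?S"
  have fin: "finite A" "finite L" using A L finite_subset_V by auto
  have "card (A \<union> L) \<le> card V" by (rule card_mono) (use A L in auto)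
  hence cX: "real (card ?X) = ?m" and cAL: "card A + card L \<le> d + 1"
    using fin A L by (auto simp: card_Diff_subset card_Un_disjoint of_nat_diff)
  have "h ?Z \<le> w A + (\<Sum>x\<in>?X. h (Inl ` A \<union> (\<lambda>y. Inr (y, x)) ` L) - w A)"
    by (rule Union_le) simp
  also have "\<dots> \<le> w A + (\<Sum>x\<in>?X. \<Gamma>)"
  proof (intro add_left_mono sum_mono)
    fix x assume "x \<in> ?X"
    have "0 \<le> h (Inl ` A \<inter> (\<lambda>y. Inr (y, x)) ` L)" using mono[of "{}"] empty by simp
    with submodular[of "Inl ` A" "(\<lambda>y. Inr (y, x)) ` L"] \<Gamma>[OF \<open>x \<in> ?X\<close>]
    show "h (Inl ` A \<union> (\<lambda>y. Inr (y, x)) ` L) - w A \<le> \<Gamma>" by simp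
  qed
  finally have Z: "h ?Z \<le> w A + ?m * \<Gamma>" using cX by simp
  \<comment> \<open>The subtracted term records that the outside messages to each node of
    \<open>D\<close> are already paid for in \<open>h ?Z\<close>.\<close>
  have "h (?Z \<union> Inl ` D) \<le> h ?Z + (\<Sum>i=card A..<card A + card D. (real d - real i) * \<beta>)
     - ?m * (real (card D) * \<beta>)" if "finite D" "D \<subseteq> L" for D
    using that
  proof (induction D)
    case (insert y D)
    let ?T = "L - insert y D"
    have "h (?Z \<union> Inl ` insert y D)
      \<le> h (insert (Inl y) (?Z \<union> Inl ` D \<union> (\<lambda>x. Inr (y, x)) ` (V - {y})))"
      by (rule mono) auto
    also have "\<dots> \<le> h (?Z \<union> Inl ` D) + real (card ?T) * \<beta>"
    proof (rule repair_step)
      show "{x \<in> V - {y}. Inl x \<notin> ?Z \<union> Inl ` D \<and> Inr (y, x) \<notin> ?Z \<union> Inl ` D} \<subseteq> ?T"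
        using insert by auto
    qed (use insert L fin in auto)
    also have "real (card ?T) = real d - real (card A + card D) - ?m"
    proof -
      have "card (insert y D) \<le> card L" using insert fin by (intro card_mono) auto
      thus ?thesis using insert fin by (simp add: card_Diff_subset of_nat_diff)
    qed
    finally show ?case using insert by (simp add: algebra_simps)
  qed simp
  from this[OF fin(2) order_refl] have "h (?Z \<union> Inl ` L)
     \<le> w A + (\<Sum>i=card A..<card A + card L. (real d - real i) * \<beta>)
       - ?m * (real (card L) * \<beta> - \<Gamma>)"
    using Z by (simp add: algebra_simps)
  moreover have "w (A \<union> L) \<le> h (?Z \<union> Inl ` L)" by (rule mono) auto
  ultimately show ?thesis by simp
qed

text \<open>Once group j, counted from 0, is added, \<open>d + 1 - card A - (j + 1) * g\<close>
  nodes remain outside, and each accounts for the term \<open>g * \<beta> - \<Gamma>\<close>. The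
  bound \<Gamma> depends on a group only through its size.\<close>

lemma groups_repair_le:
  assumes r: "r + 2 \<le> k" and g: "1 \<le> g" "g \<le> Suc r"
    and A: "A \<subseteq> C" and C: "C \<subseteq> V" "card C = card A + q * g"
  defines "\<Gamma> \<equiv> real g * ((real d - real r) * \<beta> - cap r + gap) + (\<alpha> - cap (Suc r))"
  shows "w C \<le> w A + (\<Sum>i=card A..<card A + q * g. (real d - real i) * \<beta>)
     - (\<Sum>j<q. real d + 1 - real (card A) - real (Suc j * g)) * (real g * \<beta> - \<Gamma>)"
  using A C
proof (induction q arbitrary: C)
  case 0
  hence "C = A" using finite_subset_V card_subset_eq by (metis add.right_neutral mult_0)
  thus ?case by simp
next
  case (Suc q)
  obtain C' where C': "A \<subseteq> C'" "C' \<subseteq> C" "card C' = card A + q * g"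
    using exists_subset_between[of A "card A + q * g" C] Suc finite_subset_V by auto
  let ?L = "C - C'"
  have fin: "finite C" "finite C'" using Suc C' finite_subset_V by (auto intro: finite_subset)
  have cL: "card ?L = g" using C' Suc fin by (simp add: card_Diff_subset)
  have IH: "w C' \<le> w A + (\<Sum>i=card A..<card A + q * g. (real d - real i) * \<beta>)
     - (\<Sum>j<q. real d + 1 - real (card A) - real (Suc j * g)) * (real g * \<beta> - \<Gamma>)"
    by (rule Suc.IH) (use C' Suc in auto)
  have "h ((\<lambda>y. Inr (y, x)) ` ?L) \<le> \<Gamma>" if x: "x \<in> V - (C' \<union> ?L)" for x
  proof -
    have "card ?L \<le> Suc r" "Suc r \<le> card (V - {x})" using cL g x r k_le_d by auto
    \<comment> \<open>The padding nodes in \<open>L'\<close> need only avoid x; whether they have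
      been repaired yet does not matter.\<close>
    then obtain L' where L': "?L \<subseteq> L'" "L' \<subseteq> V - {x}" "card L' = Suc r"
      using exists_subset_between[of ?L "Suc r" "V - {x}"] x Suc by blast
    have "?L \<noteq> {}" using cL g by (metis card.empty not_one_le_zero)
    from helper_messages_le[OF L'(1) this _ L'(3) r] L' x show ?thesis
      by (auto simp: \<Gamma>_def cL)
  qed
  hence "w (C' \<union> ?L) \<le> w C' + (\<Sum>i=card C'..<card C' + card ?L. (real d - real i) * \<beta>)
     - (real d + 1 - real (card C') - real (card ?L)) * (real (card ?L) * \<beta> - \<Gamma>)"
    by (intro group_repair_le) (use C' Suc in auto)
  moreover have "C' \<union> ?L = C" using C' by auto
  moreover have "(\<Sum>i=card A..<card A + Suc q * g. (real d - real i) * \<beta>)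
     = (\<Sum>i=card A..<card A + q * g. (real d - real i) * \<beta>)
     + (\<Sum>i=card A + q * g..<card A + q * g + g. (real d - real i) * \<beta>)"
    by (subst sum.atLeastLessThan_concat) (auto simp: algebra_simps)
  ultimately show ?case using IH cL C' by (simp add: algebra_simps)
qed

text \<open>The first r nodes and those after the q groups are charged by the cut-set estimate, the
  ones in between by groups. The saving contains a negative multiple of \<open>gap\<close>, so the
  inequality is solved for \<open>gap\<close>, whence the denominator. The number t tells how far
  \<open>cap r\<close> lies below repair bandwidth: \<theta> for r = p - 1 and 0 for r = p.\<close>

lemma gap_ge:
  assumes r: "r + 2 \<le> k" and g: "1 \<le> g" "g \<le> Suc r" and q: "r + q * g \<le> k"
    and capr: "cap r = (real d - real r) * \<beta> - t"
    and cap_gt: "\<And>i. r < i \<Longrightarrow> i < k \<Longrightarrow> cap i = (real d - real i) * \<beta>"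
  defines "M \<equiv> real q * (real d + 1 - real r - real g * (real q + 1) / 2)"
  shows "(M * (real g * (\<beta> - t) - (\<alpha> - cap (Suc r))) - t) / (M * real g + 1) \<le> gap"
proof -
  let ?f = "\<lambda>i. (real d - real i) * \<beta>"
  let ?\<Gamma> = "real g * (t + gap) + (\<alpha> - cap (Suc r))"
  \<comment> \<open>The numbers of outside helpers, summed over the groups by means of the
    triangular number q (q + 1) / 2.\<close>
  have M: "(\<Sum>j<q. real d + 1 - real r - real (Suc j * g)) = M"
    unfolding M_def by (induction q) (auto simp: field_simps)
  have "M \<ge> 0"
  proof -
    have "Suc j * g \<le> q * g" if "j < q" for j using that by (intro mult_le_mono1) auto
    hence "real d + 1 - real r - real (Suc j * g) \<ge> 0" if "j < q" for j
      using that q k_le_d by (smt (verit) of_nat_add of_nat_mono)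
    thus ?thesis unfolding M[symmetric] by (intro sum_nonneg) auto
  qed
  have "B = w {1..k}" using file_size[of "{1..k}"] k_le_d by simp
  also have "\<dots> \<le> w {1..r + q * g} + (\<Sum>i=r + q * g..<k. cap i)"
    using w_chain_le[of "{1..r + q * g}" "{1..k}"] q k_le_d by simp
  also have "(\<Sum>i=r + q * g..<k. cap i) \<le> (\<Sum>i=r + q * g..<k. ?f i)"
    by (intro sum_mono) (simp add: cap_def)
  also have "w {1..r + q * g} \<le> w {1..r} + (\<Sum>i=r..<r + q * g. ?f i) - M * (real g * \<beta> - ?\<Gamma>)"
    using groups_repair_le[OF r g, of "{1..r}" "{1..r + q * g}" q] q k_le_d by (simp add: capr M[symmetric])
  also have "w {1..r} \<le> (\<Sum>i=0..<r. cap i)"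
    using w_chain_le[of "{}" "{1..r}"] r k_le_d empty by simp
  finally have "B \<le> (\<Sum>i=0..<r. cap i) + ((\<Sum>i=r..<r + q * g. ?f i) + (\<Sum>i=r + q * g..<k. ?f i))
      - M * (real g * \<beta> - ?\<Gamma>)" by simp
  also have "(\<Sum>i=r..<r + q * g. ?f i) + (\<Sum>i=r + q * g..<k. ?f i) = (\<Sum>i=r..<k. ?f i)"
    using q by (simp add: sum.atLeastLessThan_concat)
  \<comment> \<open>Only the term i = r differs from \<open>cap\<close>, and it does so by
    t.\<close>
  also have "\<dots> = (\<Sum>i=r..<k. cap i) + t"
  proof -
    have "(\<Sum>i=Suc r..<k. ?f i) = (\<Sum>i=Suc r..<k. cap i)"
      by (intro sum.cong refl) (use cap_gt in auto)
    thus ?thesis using r capr by (simp add: sum.atLeast_Suc_lessThan)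
  qed
  also have "(\<Sum>i=0..<r. cap i) + ((\<Sum>i=r..<k. cap i) + t) = gap + B + t"
    using r by (simp add: gap_def sum.atLeastLessThan_concat add.assoc[symmetric])
  finally have "M * (real g * (\<beta> - t) - (\<alpha> - cap (Suc r))) - t \<le> gap * (M * real g + 1)"
    by (simp add: algebra_simps)
  moreover have "M * real g + 1 > 0" using \<open>M \<ge> 0\<close> by (simp add: add_nonneg_pos)
  ultimately show ?thesis by (simp add: pos_divide_le_eq)
qed

end

section \<open>The polymatroid of a regenerating code\<close>

text \<open>The option type gives the joint variables of all subsets one type; the constant
  \<open>None\<close> outside \<open>A\<close> makes equality of values mean equality of the
  components in \<open>A\<close>.\<close>

definition joint :: "('i \<Rightarrow> 'm \<Rightarrow> 'v) \<Rightarrow> 'i set \<Rightarrow> 'm \<Rightarrow> 'i \<Rightarrow> 'v option" where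
  "joint X A m = (\<lambda>i. if i \<in> A then Some (X i m) else None)"

lemma joint_eq_iff: "joint X A m = joint X A m' \<longleftrightarrow> (\<forall>i\<in>A. X i m = X i m')"
  by (auto simp: joint_def fun_eq_iff)

text \<open>The sum type lets contents and messages form one family.\<close>

definition code_variable :: "nat \<Rightarrow> (nat \<Rightarrow> 'm \<Rightarrow> 'w) \<Rightarrow> (nat \<Rightarrow> nat set \<Rightarrow> nat \<Rightarrow> 'm \<Rightarrow> 'h)
    \<Rightarrow> nat + nat \<times> nat \<Rightarrow> 'm \<Rightarrow> 'w + 'h" where
  "code_variable d W S i m = (case i of Inl x \<Rightarrow> Inl (W x m)
     | Inr (y, x) \<Rightarrow> Inr (S y ({1..d+1} - {y}) x m))"

lemma code_variable_simps [simp]: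
  "code_variable d W S (Inl x) m = Inl (W x m)"
  "code_variable d W S (Inr (y, x)) m = Inr (S y ({1..d+1} - {y}) x m)"
  by (simp_all add: code_variable_def)

text \<open>Each of the first d + 1 nodes has the other d as an admissible helper set. Functional
  dependence becomes an entropy inequality by \<open>ent_mono\<close>, and decodability makes the
  joint content of k nodes injective, hence of entropy B.\<close>

lemma repair_polymatroid_code:
  fixes W :: "nat \<Rightarrow> 'f::{finite,field} list \<Rightarrow> 'w"
    and S :: "nat \<Rightarrow> nat set \<Rightarrow> nat \<Rightarrow> 'f list \<Rightarrow> 'h"
  assumes code: "exact_repair_code n k d \<alpha> \<beta> B W S"
    and kd: "k \<le> d" and nd: "n \<ge> d + 1" and beta: "\<beta> \<ge> 0"
  shows "repair_polymatroid (\<lambda>A. ent B (joint (code_variable d W S) A)) d k \<alpha> \<beta> (real B)"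
proof
  let ?X = "code_variable d W S" and ?V = "{1..d+1}"
  have V: "?V \<subseteq> {1..n}" using nd by auto
  note code = code[unfolded exact_repair_code_def]
  have store: "ent B (W x) \<le> \<alpha>" if "x \<in> ?V" for x
    by (rule code[THEN conjunct1, THEN bspec]) (use V that in blast)
  have decode: "m = m'" if "K \<subseteq> ?V" "card K = k" "m \<in> msgs B" "m' \<in> msgs B" "\<forall>a\<in>K. W a m = W a m'"
    for K m m'
    using code[THEN conjunct2, THEN conjunct1, THEN spec[of _ K]] order.trans[OF that(1) V] that(2-) by blast
  have node_repair: "(\<forall>x\<in>?V - {y}. (\<forall>m\<in>msgs B. \<forall>m'\<in>msgs B. W x m = W x m' \<longrightarrow>
        S y (?V - {y}) x m = S y (?V - {y}) x m') \<and> ent B (S y (?V - {y}) x) \<le> \<beta>) \<and>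
      (\<forall>m\<in>msgs B. \<forall>m'\<in>msgs B. (\<forall>x\<in>?V - {y}. S y (?V - {y}) x m = S y (?V - {y}) x m')
        \<longrightarrow> W y m = W y m')" if y: "y \<in> ?V" for y
  proof -
    have "?V - {y} \<subseteq> {1..n} - {y}" "card (?V - {y}) = d" using V y by auto
    moreover have "y \<in> {1..n}" using V y by blast
    ultimately show ?thesis
      by (intro code[THEN conjunct2, THEN conjunct2, THEN bspec, THEN spec, THEN mp] conjI)
  qed
  show "ent B (joint ?X A) \<le> ent B (joint ?X C)" if "A \<subseteq> C" for A C
    by (rule ent_mono) (use that in \<open>auto simp: joint_eq_iff\<close>)
  show "ent B (joint ?X (A \<union> C)) + ent B (joint ?X (A \<inter> C)) \<le> ent B (joint ?X A) + ent B (joint ?X C)"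
    for A C
    by (rule ent_submodular) (auto simp: joint_eq_iff)
  show "ent B (joint ?X {}) = 0"
    by (rule ent_const) (simp add: joint_eq_iff)
  show "ent B (joint ?X {Inl x}) \<le> \<alpha>" if "x \<in> ?V" for x
    by (rule order.trans[OF ent_mono store[OF that]]) (simp add: joint_eq_iff)
  show "ent B (joint ?X {Inr (y, x)}) \<le> \<beta>" if "x \<in> ?V" "y \<in> ?V" "x \<noteq> y" for x y
  proof -
    have "ent B (joint ?X {Inr (y, x)}) \<le> ent B (S y (?V - {y}) x)"
      by (rule ent_mono) (simp add: joint_eq_iff)
    also have "\<dots> \<le> \<beta>" using node_repair[of y] that by blast
    finally show ?thesis .
  qed
  show "ent B (joint ?X {Inr (y, x), Inl x}) \<le> ent B (joint ?X {Inl x})"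
    if "x \<in> ?V" "y \<in> ?V" "x \<noteq> y" for x y
  proof (rule ent_mono)
    fix m m' :: "'f list"
    assume m: "m \<in> msgs B" "m' \<in> msgs B" and "joint ?X {Inl x} m = joint ?X {Inl x} m'"
    hence W: "W x m = W x m'" by (simp add: joint_eq_iff)
    hence "S y (?V - {y}) x m = S y (?V - {y}) x m'" using node_repair[of y] m that by blast
    thus "joint ?X {Inr (y, x), Inl x} m = joint ?X {Inr (y, x), Inl x} m'"
      using W by (simp add: joint_eq_iff)
  qed
  show "ent B (joint ?X (insert (Inl y) ((\<lambda>x. Inr (y, x)) ` (?V - {y}))))
      \<le> ent B (joint ?X ((\<lambda>x. Inr (y, x)) ` (?V - {y})))" if y: "y \<in> ?V" for y
  proof (rule ent_mono)
    fix m m' :: "'f list"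
    assume m: "m \<in> msgs B" "m' \<in> msgs B"
      and "joint ?X ((\<lambda>x. Inr (y, x)) ` (?V - {y})) m = joint ?X ((\<lambda>x. Inr (y, x)) ` (?V - {y})) m'"
    hence S: "\<forall>x\<in>?V - {y}. S y (?V - {y}) x m = S y (?V - {y}) x m'"
      unfolding joint_eq_iff by simp
    hence "W y m = W y m'" using node_repair[OF y] m by blast
    thus "joint ?X (insert (Inl y) ((\<lambda>x. Inr (y, x)) ` (?V - {y}))) m
        = joint ?X (insert (Inl y) ((\<lambda>x. Inr (y, x)) ` (?V - {y}))) m'"
      using S unfolding joint_eq_iff by simp
  qed
  show "ent B (joint ?X (Inl ` K)) = real B" if K: "K \<subseteq> ?V" "card K = k" for K
  proof (rule ent_inj, rule inj_onI)
    fix m m' :: "'f list"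
    assume m: "m \<in> msgs B" "m' \<in> msgs B" and "joint ?X (Inl ` K) m = joint ?X (Inl ` K) m'"
    thus "m = m'" using decode[OF K m] by (simp add: joint_eq_iff)
  qed
qed (use kd beta in auto)

section \<open>The two bounds at a given operating point\<close>

context repair_polymatroid
begin

lemma Bhat_minus_file_size: "Bhat k d \<alpha> \<beta> - B = gap"
proof -
  have "(\<Sum>i=1..k. min \<alpha> ((real d - real i + 1) * \<beta>)) = (\<Sum>i<k. cap i)"
    by (simp add: sum.atLeast1_atMost_eq cap_def algebra_simps)
  thus ?thesis by (simp add: Bhat_def gap_def atLeast0LessThan)
qed

context
  fixes p :: nat and \<theta> :: real
  assumes alpha: "\<alpha> = (real d - real p + 1) * \<beta> - \<theta>"
    and theta: "0 \<le> \<theta>" "\<theta> < \<beta>" and p: "1 \<le> p"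
begin

text \<open>The minimum in \<open>cap\<close> switches at p: storage is the bottleneck before it
  and, by \<open>cap_ge\<close>, repair bandwidth from p on.\<close>

lemma cap_less: "i < p \<Longrightarrow> cap i = \<alpha>"
proof -
  assume "i < p"
  hence "(real d - real p + 1) * \<beta> \<le> (real d - real i) * \<beta>"
    using beta_nonneg by (intro mult_right_mono) auto
  hence "\<alpha> \<le> (real d - real i) * \<beta>" using alpha theta by linarith
  thus ?thesis by (simp add: cap_def)
qed

lemma cap_ge: "p \<le> i \<Longrightarrow> cap i = (real d - real i) * \<beta>"
proof -
  assume "p \<le> i"
  hence "(real d - real i) * \<beta> \<le> (real d - real p) * \<beta>"
    using beta_nonneg by (intro mult_right_mono) auto
  moreover have "(real d - real p) * \<beta> \<le> \<alpha>" using alpha theta by (simp add: distrib_right)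
  ultimately show ?thesis by (simp add: cap_def)
qed

text \<open>Take \<open>gap_ge\<close> with r = p - 1 and t = \<theta>. If the k - p + 1 nodes left
  are fewer than p, they form one group; otherwise as many groups of the maximal size p are used as
  fit.\<close>

lemma eps0_le_gap:
  assumes "2 \<le> p" "p + 1 \<le> k"
  shows "eps0 k d p \<beta> \<theta> \<le> gap"
proof -
  have rp: "real (p - 1) = real p - 1" using p by simp
  have cap1: "cap (p - 1) = (real d - real (p - 1)) * \<beta> - \<theta>"
  proof -
    have "cap (p - 1) = \<alpha>" by (rule cap_less) (use p in simp)
    also note alpha
    finally show ?thesis unfolding rp by (simp add: algebra_simps)
  qed
  have diff: "\<alpha> - cap (Suc (p - 1)) = \<beta> - \<theta>"
  proof -
    have "cap (Suc (p - 1)) = (real d - real p + 1) * \<beta> - \<beta>"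
      using p by (simp add: cap_ge algebra_simps)
    thus ?thesis using alpha by linarith
  qed
  have bound: "(real q * (real d + 1 - real (p - 1) - real g * (real q + 1) / 2)
        * (real g * (\<beta> - \<theta>) - (\<beta> - \<theta>)) - \<theta>)
      / (real q * (real d + 1 - real (p - 1) - real g * (real q + 1) / 2) * real g + 1) \<le> gap"
    if "1 \<le> g" "g \<le> p" "p - 1 + q * g \<le> k" for q g
    using gap_ge[of "p - 1" g q \<theta>, OF _ _ _ _ cap1] that assms cap_ge
    unfolding diff by simp
  show ?thesis
  proof (cases "k - p + 1 < p")
    case True
    have g: "real (k - p + 1) = real k - real p + 1" using assms by simp
    \<comment> \<open>With a single group, the coefficient is the number of nodes outside all
      k.\<close>
    have M: "real 1 * (real d + 1 - real (p - 1) - real (k - p + 1) * (real 1 + 1) / 2) = real d - real k + 1"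
      unfolding g rp by (simp add: field_simps)
    have N: "real (k - p + 1) * (\<beta> - \<theta>) - (\<beta> - \<theta>) = (real k - real p) * (\<beta> - \<theta>)"
      unfolding g by (simp add: algebra_simps)
    show ?thesis
      using bound[of "k - p + 1" 1, unfolded M N, unfolded g] True assms
      by (simp add: eps0_def mult.assoc)
  next
    case False
    define q where "q = (k - p + 1) div p"
    have "q * p \<le> k - p + 1" unfolding q_def by simp
    hence "p - 1 + q * p \<le> k" using assms by simp
    \<comment> \<open>This is the average number of outside helpers per group.\<close>
    have M: "real d + 1 - real (p - 1) - real p * (real q + 1) / 2
        = real d - real p * (real q + 3) / 2 + 2"
      unfolding rp by (simp add: field_simps)
    have N: "real p * (\<beta> - \<theta>) - (\<beta> - \<theta>) = (real p - 1) * (\<beta> - \<theta>)"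
      by (simp add: algebra_simps)
    have "eps0 k d p \<beta> \<theta> = (real q * (real d - real p * (real q + 3) / 2 + 2)
        * ((real p - 1) * (\<beta> - \<theta>)) - \<theta>)
      / (real q * (real d - real p * (real q + 3) / 2 + 2) * real p + 1)"
      unfolding eps0_def Let_def q_def[symmetric] using False by (simp add: mult_ac)
    thus ?thesis
      using bound[of p q, unfolded M N] \<open>p - 1 + q * p \<le> k\<close> p by simp
  qed
qed

text \<open>Take \<open>gap_ge\<close> with r = p and t = 0, so that \<theta> enters only through
  \<open>\<alpha> - cap (Suc p)\<close>. Now k - p nodes are left and the maximal group size is p +
  1.\<close>

lemma eps1_le_gap:
  assumes "p + 2 \<le> k"
  shows "eps1 k d p \<beta> \<theta> \<le> gap"
proof -
  have cap1: "cap p = (real d - real p) * \<beta> - 0"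
    using cap_ge[of p] by simp
  have diff: "\<alpha> - cap (Suc p) = 2 * \<beta> - \<theta>"
  proof -
    have "cap (Suc p) = (real d - real p + 1) * \<beta> - 2 * \<beta>" by (simp add: cap_ge algebra_simps)
    thus ?thesis using alpha by linarith
  qed
  have bound: "(real q * (real d + 1 - real p - real g * (real q + 1) / 2)
        * (real g * \<beta> - (2 * \<beta> - \<theta>)))
      / (real q * (real d + 1 - real p - real g * (real q + 1) / 2) * real g + 1) \<le> gap"
    if "1 \<le> g" "g \<le> Suc p" "p + q * g \<le> k" for q g
    using gap_ge[of p g q 0, OF _ _ _ _ cap1] that assms cap_ge
    unfolding diff by simp
  show ?thesis
  proof (cases "k - p < p + 1")
    case True
    have g: "real (k - p) = real k - real p" using assms by simp
    have M: "real 1 * (real d + 1 - real p - real (k - p) * (real 1 + 1) / 2) = real d - real k + 1"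
      unfolding g by (simp add: field_simps)
    have N: "real (k - p) * \<beta> - (2 * \<beta> - \<theta>) = (real k - real p - 2) * \<beta> + \<theta>"
      unfolding g by (simp add: algebra_simps)
    show ?thesis
      using bound[of "k - p" 1, unfolded M N, unfolded g] True assms
      by (simp add: eps1_def)
  next
    case False
    define q where "q = (k - p) div (p + 1)"
    have "q * (p + 1) \<le> k - p" unfolding q_def by (rule div_times_less_eq_dividend)
    hence "p + q * (p + 1) \<le> k" using assms by linarith
    have M: "real d + 1 - real p - real (p + 1) * (real q + 1) / 2
        = real d - real (p + 1) * (real q + 3) / 2 + 2"
      by (simp add: field_simps)
    have N: "real (p + 1) * \<beta> - (2 * \<beta> - \<theta>) = (real p - 1) * \<beta> + \<theta>"
      by (simp add: algebra_simps)
    have "eps1 k d p \<beta> \<theta> = real q * (real d - real (p + 1) * (real q + 3) / 2 + 2)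
        * ((real p - 1) * \<beta> + \<theta>)
      / (real q * (real d - real (p + 1) * (real q + 3) / 2 + 2) * real (p + 1) + 1)"
      unfolding eps1_def Let_def q_def[symmetric] using False by (simp add: mult_ac add.commute)
    thus ?thesis
      using bound[of "p + 1" q, unfolded M N] \<open>p + q * (p + 1) \<le> k\<close> by simp
  qed
qed

end

end

theorem theorem1:
  fixes W :: "nat \<Rightarrow> 'f::{finite,field} list \<Rightarrow> 'w"
    and S :: "nat \<Rightarrow> nat set \<Rightarrow> nat \<Rightarrow> 'f list \<Rightarrow> 'h"
    and n k d p B :: nat and \<alpha> \<beta> \<theta> :: real
  assumes code: "exact_repair_code n k d \<alpha> \<beta> B W S"
    and kd: "k \<le> d" and dn: "d < n" and nd: "n \<ge> d + 1" and k3: "k \<ge> 3"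
    and beta_pos: "\<beta> > 0" and alpha_pos: "\<alpha> > 0"
    and p: "1 \<le> p" "p \<le> k"
    and theta: "0 \<le> \<theta>" "\<theta> < \<beta>" and theta_k: "p = k \<longrightarrow> \<theta> = 0"
    and alpha: "\<alpha> = (real d - real p + 1) * \<beta> - \<theta>"
  shows "(p = 1 \<and> \<theta> \<noteq> 0 \<longrightarrow> real B \<le> Bhat k d \<alpha> \<beta> - eps1 k d p \<beta> \<theta>) \<and>
         (2 \<le> p \<and> p \<le> k - 2 \<longrightarrow>
            real B \<le> Bhat k d \<alpha> \<beta> - max (eps0 k d p \<beta> \<theta>) (eps1 k d p \<beta> \<theta>)) \<and>
         (p = k - 1 \<and> \<theta> < (real d - real k + 1) / (real d - real k + 2) * \<beta> \<longrightarrow>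
            real B \<le> Bhat k d \<alpha> \<beta> - eps0 k d p \<beta> \<theta>)"
proof -
  interpret repair_polymatroid "\<lambda>A. ent B (joint (code_variable d W S) A)" d k \<alpha> \<beta> "real B"
    by (rule repair_polymatroid_code[OF code kd nd]) (use beta_pos in simp)
  note e0 = eps0_le_gap[OF alpha theta p(1)] and e1 = eps1_le_gap[OF alpha theta p(1)]
  have "real B \<le> Bhat k d \<alpha> \<beta> - e" if "e \<le> gap" for e
    using that Bhat_minus_file_size by simp
  \<comment> \<open>The case p = 1 satisfies \<open>p + 2 \<le> k\<close> because
    \<open>k \<ge> 3\<close>.\<close>
  moreover have "eps1 k d p \<beta> \<theta> \<le> gap" if "p = 1 \<or> p \<le> k - 2"
    using that k3 p by (intro e1) auto
  moreover have "eps0 k d p \<beta> \<theta> \<le> gap" if "2 \<le> p" "p \<le> k - 1"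
    using that k3 by (intro e0) auto
  ultimately show ?thesis using k3 by auto
qed

end
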